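(* Let $n,m\ge 1$, let $a_1,\dots,a_n,b_1,\dots,b_n$ be positive real numbers and let $k_1,\dots,k_m\in[0,\infty)$. Then $$\sum_{i=1}^n a_i\log\prod_{s=1}^m\left(\frac{a_i}{b_i}+k_s\right)\ \ge\ \left(\sum_{i=1}^n a_i\right)\log\prod_{s=1}^m\left(\frac{\sum_{i=1}^n a_i}{\sum_{i=1}^n b_i}+k_s\right).$$
   Context: $\log$ is the natural logarithm. *)

theory Defs
  imports Complex_Main
begin

end

theory Submission
  imports Defs
begin

text \<open>The logarithms of the products split into sums over \<open>s\<close>, so it suffices to treat one
  shift \<open>k\<close>. There the claim is Jensen's inequality, with weights \<open>b i\<close>, for the convex function
  \<open>x \<mapsto> x * ln (x + k)\<close>; it follows by summing the tangent line inequality at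
  \<open>t = (\<Sum>i. a i) / (\<Sum>i. b i)\<close> over the points \<open>a i / b i\<close>.\<close>

text \<open>The left side is the tangent at \<open>t\<close> of \<open>x * ln (x + k)\<close>, with
  the two \<open>ln (t + k)\<close> terms merged. The bound comes from
  \<open>ln u \<le> u - 1\<close> at \<open>u = (t + k) / (x + k)\<close>.\<close>

lemma mult_ln_shift_tangent:
  fixes x t k :: real
  assumes "x > 0" "t > 0" "k \<ge> 0"
  shows "x * ln (t + k) + t / (t + k) * (x - t) \<le> x * ln (x + k)"
proof -
  have pos: "x + k > 0" "t + k > 0"
    using assms by auto
  have "ln ((t + k) / (x + k)) \<le> (t + k) / (x + k) - 1"
    using pos by (intro ln_le_minus_one) simp
  then have "(x - t) / (x + k) \<le> ln (x + k) - ln (t + k)"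
    using pos by (simp add: ln_div field_simps)
  then have "x * ((x - t) / (x + k)) \<le> x * (ln (x + k) - ln (t + k))"
    using assms by (intro mult_left_mono) auto
  \<comment> \<open>The slope \<open>x / (x + k)\<close> obtained so far must be replaced by
    \<open>t / (t + k)\<close>; the error is a nonnegative multiple of a square.\<close>
  moreover have "x * ((x - t) / (x + k)) - t / (t + k) * (x - t)
      = k * (x - t)\<^sup>2 / ((x + k) * (t + k))"
    using pos by (simp add: field_simps power2_eq_square)
  moreover have "\<dots> \<ge> 0"
    using assms pos by simp
  ultimately show ?thesis
    by (simp add: right_diff_distrib)
qed

lemma shifted_log_sum_inequality:
  fixes a b :: "'i \<Rightarrow> real" and k :: real
  assumes "finite I" "I \<noteq> {}"
    and a: "\<And>i. i \<in> I \<Longrightarrow> a i > 0" and b: "\<And>i. i \<in> I \<Longrightarrow> b i > 0" and "k \<ge> 0"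
  shows "sum a I * ln (sum a I / sum b I + k) \<le> (\<Sum>i\<in>I. a i * ln (a i / b i + k))"
proof -
  define t where "t = sum a I / sum b I"
  have B: "sum b I > 0" and "t > 0"
    using assms by (auto simp: t_def intro!: sum_pos divide_pos_pos)
  have "a i * ln (t + k) + t / (t + k) * (a i - t * b i) \<le> a i * ln (a i / b i + k)"
    if "i \<in> I" for i
  proof -
    \<comment> \<open>Tangent inequality at \<open>a i / b i\<close>, scaled by the Jensen weight
      \<open>b i\<close>.\<close>
    have "b i * (a i / b i * ln (t + k) + t / (t + k) * (a i / b i - t))
        \<le> b i * (a i / b i * ln (a i / b i + k))"
      using a[OF that] b[OF that] \<open>t > 0\<close> \<open>k \<ge> 0\<close>
      by (intro mult_left_mono mult_ln_shift_tangent) auto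
    moreover have "b i * (a i / b i * ln (t + k) + t / (t + k) * (a i / b i - t))
        = b i * (a i / b i) * ln (t + k) + t / (t + k) * (b i * (a i / b i) - t * b i)"
      by (simp only: algebra_simps)
    ultimately show ?thesis
      using b[OF that] by simp
  qed
  then have "(\<Sum>i\<in>I. a i * ln (t + k) + t / (t + k) * (a i - t * b i))
      \<le> (\<Sum>i\<in>I. a i * ln (a i / b i + k))"
    by (rule sum_mono)
  also have "(\<Sum>i\<in>I. a i * ln (t + k) + t / (t + k) * (a i - t * b i))
      = sum a I * ln (t + k) + t / (t + k) * (sum a I - t * sum b I)"
    by (simp only: sum.distrib sum_subtractf flip: sum_distrib_left sum_distrib_right)
  \<comment> \<open>The linear corrections cancel because \<open>t\<close> is the weighted mean of
    the points \<open>a i / b i\<close>.\<close>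
  also have "sum a I - t * sum b I = 0"
    using B by (simp add: t_def)
  finally show ?thesis
    by (simp add: t_def)
qed

theorem corollary5p6:
  fixes n m :: nat and a b k :: "nat \<Rightarrow> real"
  assumes "n \<ge> 1" and "m \<ge> 1"
    and "\<And>i. i \<in> {1..n} \<Longrightarrow> a i > 0"
    and "\<And>i. i \<in> {1..n} \<Longrightarrow> b i > 0"
    and "\<And>s. s \<in> {1..m} \<Longrightarrow> k s \<ge> 0"
  shows "(\<Sum>i=1..n. a i * ln (\<Prod>s=1..m. (a i / b i + k s)))
    \<ge> (\<Sum>i=1..n. a i) * ln (\<Prod>s=1..m. ((\<Sum>i=1..n. a i) / (\<Sum>i=1..n. b i) + k s))"
proof -
  \<comment> \<open>With \<open>x > 0\<close> every factor is positive, even where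
    \<open>k s = 0\<close>, so the logarithm splits.\<close>
  have ln_shift_prod: "ln (\<Prod>s=1..m. x + k s) = (\<Sum>s=1..m. ln (x + k s))" if "x > 0" for x
    using that assms(5) by (intro ln_prod) (auto simp: add_nonneg_eq_0_iff)
  have AB: "sum a {1..n} / sum b {1..n} > 0"
    using assms(1,3,4) by (intro divide_pos_pos sum_pos) auto
  have "sum a {1..n} * ln (\<Prod>s=1..m. sum a {1..n} / sum b {1..n} + k s)
      = (\<Sum>s=1..m. sum a {1..n} * ln (sum a {1..n} / sum b {1..n} + k s))"
    by (simp only: ln_shift_prod[OF AB] sum_distrib_left)
  \<comment> \<open>The single-shift inequality is applied separately for each
    \<open>s\<close>.\<close>
  also have "\<dots> \<le> (\<Sum>s=1..m. \<Sum>i=1..n. a i * ln (a i / b i + k s))"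
    using assms by (intro sum_mono shifted_log_sum_inequality) auto
  also have "\<dots> = (\<Sum>i=1..n. \<Sum>s=1..m. a i * ln (a i / b i + k s))"
    by (rule sum.swap)
  also have "\<dots> = (\<Sum>i=1..n. a i * ln (\<Prod>s=1..m. a i / b i + k s))"
    using assms(3,4) by (intro sum.cong) (auto simp: ln_shift_prod sum_distrib_left simp del: One_nat_def)
  finally show ?thesis .
qed

end
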